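(* Suppose Assumption A (see context) holds. Let $u$ be the bounded viscosity solution of the HJB variational inequality (VI) and, for each $\rho>0$, let $u^\rho$ be the bounded viscosity solution of the penalized equation $(P_\rho)$ (see context). Suppose the estimate $0\le u(t,x)-u^\rho(t,x)\le C_0\rho^{-\beta}$ holds for all $(t,x)\in\bar{\mathcal Q}_T$ and $\rho>0$, for some constants $C_0>0$ and $\beta\in(0,1]$. Define $$\Gamma=\{\mathbf x\in\bar{\mathcal Q}_T\mid u(\mathbf x)=\zeta(\mathbf x)\},\qquad \Gamma_\rho=\{\mathbf x\in\bar{\mathcal Q}_T\mid \zeta(\mathbf x)-C_0\rho^{-\beta}\le u^\rho(\mathbf x)\le\zeta(\mathbf x)\},\quad \rho>0.$$ Then for any given compact set $K\subset\bar{\mathcal Q}_T$, $$\lim_{\rho\to\infty}d_{\mathcal H}(\Gamma_\rho\cap K,\Gamma\cap K)=\lim_{\rho\to\infty}\ \sup_{\mathbf y\in\Gamma_\rho\cap K}\ \inf_{\mathbf x\in\Gamma\cap K}|\mathbf x-\mathbf y|=0,$$ where $d_{\mathcal H}$ denotes the Hausdorff metric.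
   Context: Fix $T>0$ and dimensions $d,n$; $\mathcal Q_T=(0,T]\times\mathbb R^d$, $\bar{\mathcal Q}_T=[0,T]\times\mathbb R^d$, $E=\mathbb R^n\setminus\{0\}$, and $\nu$ is a Lévy measure on $E$ (positive measure with $\int_E(1\wedge|e|^2)\nu(de)<\infty$). For a function $h$ on $\bar{\mathcal Q}_T$: $|h|_0=\sup|h|$, $|h|_1=\sup_{t,\,x\ne x'}|h(t,x)-h(t,x')|/|x-x'|$, $\|h\|_1=|h|_0+|h|_1$ (similarly for time-independent functions). $a^+=\max(a,0)$. The Hausdorff metric is $d_{\mathcal H}(S,S')=\max\{\sup_{x\in S}\inf_{y\in S'}|x-y|,\sup_{x\in S'}\inf_{y\in S}|x-y|\}$, with the conventions $\inf\emptyset=+\infty$, $\sup\emptyset=0$. Data: $b^\alpha:\bar{\mathcal Q}_T\to\mathbb R^d$, $\sigma^\alpha:\bar{\mathcal Q}_T\to\mathbb R^{d\times d}$, $\eta^\alpha:\bar{\mathcal Q}_T\times E\to\mathbb R^d$, $\gamma:\bar{\mathcal Q}_T\times E\to\mathbb R$, $\zeta:\bar{\mathcal Q}_T\to\mathbb R$, $g:\mathbb R^d\to\mathbb R$, $m:\mathbb R\to\mathbb R$, $f:\mathbf A\times\bar{\mathcal Q}_T\times\mathbb R\times\mathbb R^d\times\mathbb R\to\mathbb R$. Operators: $L^\alpha=A^\alpha+K^\alpha$, $$A^\alpha\phi=\tfrac12\mathrm{tr}(\sigma^\alpha(\sigma^\alpha)^TD^2\phi)+b^\alpha\cdot D\phi,\quad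 K^\alpha\phi(t,x)=\int_E\big(\phi(t,x+\eta^\alpha(t,x,e))-\phi(t,x)-\eta^\alpha(t,x,e)\cdot D\phi(t,x)\big)\nu(de),$$ $$B^\alpha\phi(t,x)=\int_E m\big(\phi(t,x+\eta^\alpha(t,x,e))-\phi(t,x)\big)\gamma(t,x,e)\,\nu(de).$$ Assumption A. $\mathbf A$ is a compact subset of a metric space, and there exist $C>0$, $\mu\in\mathbb R$ such that for all $(\alpha,e,t,x,z,k)$ and $y,y'\in\mathbb R$: (1) $b^\alpha,\sigma^\alpha,\eta^\alpha$ are continuous in $\alpha,t$; $\gamma,\zeta$ are continuous in $t$; $g(x)\ge\zeta(0,x)$; $\gamma\ge0$; $\|b^\alpha\|_1+\|\sigma^\alpha\|_1+\|\zeta\|_1+\|g\|_1\le C$; $\|\eta^\alpha(\cdot,\cdot,e)\|_1+|\gamma(\cdot,\cdot,e)|_0\le C(1\wedge|e|)$; $|\gamma(\cdot,\cdot,e)|_1\le C(1\wedge|e|^2)$. (2) $f$ is continuous; $|f^\alpha(t,x,0,0,0)|\le C$; there is a continuous increasing $\varphi:[0,\infty)\to[0,\infty)$ with $(y-y')(f^\alpha(t,x,y,z,k)-f^\alpha(t,x,y',z,k))\le\mu|y-y'|^2$ and $|f^\alpha(t,x,y,z,k)|\le|f^\alpha(t,x,0,0,0)|+\varphi(|y|)+C(|z|+|k|)$; $k\mapsto f^\alpha(t,x,y,z,k)$ is non-decreasing; $f$ is Lipschitz in $x,z,k$ with constant $C$, uniformly in $\alpha,t,y$. (3) $m$ is Lipschitz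 continuous, non-decreasing, $m(0)=0$. Equations. Put $H[\phi]=\phi_t+\inf_{\alpha\in\mathbf A}\big(-L^\alpha\phi-f^\alpha(t,x,\phi,(\sigma^\alpha)^TD\phi,B^\alpha\phi)\big)$. (VI): $\min\{u-\zeta,H[u]\}=0$ in $\mathcal Q_T$, $u(0,\cdot)=g$. $(P_\rho)$: $H[u]-\rho(\zeta-u)^+=0$ in $\mathcal Q_T$, $u(0,\cdot)=g$. Write $G[\phi]=\min\{\phi-\zeta,H[\phi]\}$ for (VI) and $G[\phi]=H[\phi]-\rho(\zeta-\phi)^+$ for $(P_\rho)$. An upper (resp. lower) semicontinuous $u$ is a viscosity subsolution (resp. supersolution) if for every $(t_0,x_0)\in\bar{\mathcal Q}_T$ and $\phi\in C^{1,2}(\bar{\mathcal Q}_T)$ with $\phi(t_0,x_0)=u(t_0,x_0)$ such that $u-\phi$ attains its global maximum (resp. minimum) at $(t_0,x_0)$, one has $G[\phi](t_0,x_0)\le0$ (resp. $\ge0$) if $t_0>0$, and $\min\{G[\phi](0,x_0),u(0,x_0)-g(x_0)\}\le0$ (resp. $\max\{\cdot,\cdot\}\ge0$) if $t_0=0$. A continuous function that is both is a viscosity solution. *)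

theory Defs
  imports "HOL-Analysis.Analysis"
begin

section \<open>Data\<close>

text \<open>
  A space-time point is a pair of type \<open>real \<times> (real ^ 'd)\<close>, whose distance is the Euclidean one.
  Every function of a space-time point, and every function of a mark in \<open>real^'n\<close>, is total; only
  its values on \<open>Qbar T\<close>, respectively on \<open>-{0}\<close>, are ever used.
\<close>

type_synonym 'd point = "real \<times> (real ^ 'd)"

record ('a, 'd::finite, 'n::finite) hjb_data =
  Tm :: real
  ctrl :: "'a set"
  levy :: "(real ^ 'n) measure"
  drift :: "'a \<Rightarrow> 'd point \<Rightarrow> real ^ 'd"
  diffus :: "'a \<Rightarrow> 'd point \<Rightarrow> real ^ 'd ^ 'd"
  jump :: "'a \<Rightarrow> 'd point \<Rightarrow> real ^ 'n \<Rightarrow> real ^ 'd"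
  weight :: "'d point \<Rightarrow> real ^ 'n \<Rightarrow> real"
  obst :: "'d point \<Rightarrow> real"
  init :: "real ^ 'd \<Rightarrow> real"
  modm :: "real \<Rightarrow> real"
  driver :: "'a \<Rightarrow> 'd point \<Rightarrow> real \<Rightarrow> real ^ 'd \<Rightarrow> real \<Rightarrow> real"

text \<open>
  The fields are, in order, $T$, $\mathbf A$, $\nu$, $b$, $\sigma$, $\eta$, $\gamma$, $\zeta$, $g$,
  $m$ and $f$.
\<close>

definition Qbar :: "real \<Rightarrow> ('d::finite) point set"
  where "Qbar T = {0..T} \<times> UNIV"

section \<open>Norms and the standing assumption\<close>

text \<open>
  The (semi)norms take values in \<^typ>\<open>ennreal\<close>, so that they are \<open>\<infinity>\<close> for unbounded functions and
  non-Lipschitz functions. Matrices carry the Frobenius norm. A time-independent function \<open>h\<close> is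
  measured as \<open>h \<circ> snd\<close>.
\<close>

definition norm0 :: "real \<Rightarrow> (('d::finite) point \<Rightarrow> 'b::real_normed_vector) \<Rightarrow> ennreal"
  where "norm0 T h = (SUP p\<in>Qbar T. ennreal (norm (h p)))"

definition semi1 :: "real \<Rightarrow> (('d::finite) point \<Rightarrow> 'b::real_normed_vector) \<Rightarrow> ennreal"
  where "semi1 T h =
    (SUP t\<in>{0..T}. SUP x. SUP x'\<in>-{x}. ennreal (norm (h (t, x) - h (t, x')) / norm (x - x')))"

definition norm1 :: "real \<Rightarrow> (('d::finite) point \<Rightarrow> 'b::real_normed_vector) \<Rightarrow> ennreal"
  where "norm1 T h = norm0 T h + semi1 T h"

definition levy_measure :: "(real ^ 'n::finite) measure \<Rightarrow> bool"
  where "levy_measure \<nu> \<longleftrightarrow>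
    sets \<nu> = sets (restrict_space borel (-{0})) \<and>
    (\<integral>\<^sup>+ e. ennreal (min 1 ((norm e)\<^sup>2)) \<partial>\<nu>) < \<infinity>"

definition assumption_coeff :: "('a::metric_space, 'd::finite, 'n::finite) hjb_data \<Rightarrow> real \<Rightarrow> bool"
  where "assumption_coeff D C \<longleftrightarrow>
    (\<forall>x. continuous_on (ctrl D \<times> {0..Tm D}) (\<lambda>(\<alpha>, t). drift D \<alpha> (t, x))) \<and>
    (\<forall>x. continuous_on (ctrl D \<times> {0..Tm D}) (\<lambda>(\<alpha>, t). diffus D \<alpha> (t, x))) \<and>
    (\<forall>x. \<forall>e\<in>-{0}. continuous_on (ctrl D \<times> {0..Tm D}) (\<lambda>(\<alpha>, t). jump D \<alpha> (t, x) e)) \<and>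
    (\<forall>x. \<forall>e\<in>-{0}. continuous_on {0..Tm D} (\<lambda>t. weight D (t, x) e)) \<and>
    (\<forall>x. continuous_on {0..Tm D} (\<lambda>t. obst D (t, x))) \<and>
    (\<forall>x. init D x \<ge> obst D (0, x)) \<and>
    (\<forall>p\<in>Qbar (Tm D). \<forall>e\<in>-{0}. weight D p e \<ge> 0) \<and>
    (\<forall>\<alpha>\<in>ctrl D. norm1 (Tm D) (drift D \<alpha>) + norm1 (Tm D) (diffus D \<alpha>) + norm1 (Tm D) (obst D)
        + norm1 (Tm D) ((init D \<circ> snd) :: 'd point \<Rightarrow> real) \<le> ennreal C) \<and>
    (\<forall>\<alpha>\<in>ctrl D. \<forall>e\<in>-{0}.
        norm1 (Tm D) (\<lambda>p. jump D \<alpha> p e) + norm0 (Tm D) (\<lambda>p. weight D p e)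
          \<le> ennreal (C * min 1 (norm e))) \<and>
    (\<forall>e\<in>-{0}. semi1 (Tm D) (\<lambda>p. weight D p e) \<le> ennreal (C * min 1 ((norm e)\<^sup>2)))"

definition assumption_driver ::
    "('a::metric_space, 'd::finite, 'n::finite) hjb_data \<Rightarrow> real \<Rightarrow> real \<Rightarrow> bool"
  where "assumption_driver D C \<mu> \<longleftrightarrow>
    continuous_on (ctrl D \<times> Qbar (Tm D) \<times> UNIV \<times> UNIV \<times> UNIV) (\<lambda>(\<alpha>, p, y, z, k). driver D \<alpha> p y z k) \<and>
    (\<forall>\<alpha>\<in>ctrl D. \<forall>p\<in>Qbar (Tm D). \<bar>driver D \<alpha> p 0 0 0\<bar> \<le> C) \<and>
    (\<exists>\<phi>. continuous_on {0..} \<phi> \<and> mono_on {0..} \<phi> \<and> (\<forall>r\<ge>0. \<phi> r \<ge> 0) \<and>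
      (\<forall>\<alpha>\<in>ctrl D. \<forall>p\<in>Qbar (Tm D). \<forall>y z k.
        (\<forall>y'. (y - y') * (driver D \<alpha> p y z k - driver D \<alpha> p y' z k) \<le> \<mu> * \<bar>y - y'\<bar>\<^sup>2) \<and>
        \<bar>driver D \<alpha> p y z k\<bar> \<le> \<bar>driver D \<alpha> p 0 0 0\<bar> + \<phi> \<bar>y\<bar> + C * (norm z + \<bar>k\<bar>))) \<and>
    (\<forall>\<alpha>\<in>ctrl D. \<forall>p\<in>Qbar (Tm D). \<forall>y z. mono (driver D \<alpha> p y z)) \<and>
    (\<forall>\<alpha>\<in>ctrl D. \<forall>t\<in>{0..Tm D}. \<forall>x x' y z z' k k'.
        \<bar>driver D \<alpha> (t, x) y z k - driver D \<alpha> (t, x') y z' k'\<bar>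
          \<le> C * (norm (x - x') + norm (z - z') + \<bar>k - k'\<bar>))"

text \<open>
  The control set is required to be nonempty: otherwise the infimum in the Hamiltonian would not be
  a real number.
\<close>

definition assumption_A :: "('a::metric_space, 'd::finite, 'n::finite) hjb_data \<Rightarrow> bool"
  where "assumption_A D \<longleftrightarrow>
    Tm D > 0 \<and> levy_measure (levy D) \<and>
    compact (ctrl D) \<and> ctrl D \<noteq> {} \<and>
    (\<exists>C>0. \<exists>\<mu>. assumption_coeff D C \<and> assumption_driver D C \<mu>) \<and>
    (\<exists>L. L-lipschitz_on UNIV (modm D)) \<and> mono (modm D) \<and> modm D 0 = 0"

section \<open>Operators\<close>

text \<open>Time derivatives are one-sided at the end points of \<open>{0..T}\<close>.\<close>

definition time_deriv :: "real \<Rightarrow> (('d::finite) point \<Rightarrow> real) \<Rightarrow> 'd point \<Rightarrow> real"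
  where "time_deriv T \<phi> = (\<lambda>(t, x). vector_derivative (\<lambda>s. \<phi> (s, x)) (at t within {0..T}))"

definition space_grad :: "(('d::finite) point \<Rightarrow> real) \<Rightarrow> 'd point \<Rightarrow> real ^ 'd"
  where "space_grad \<phi> = (\<lambda>(t, x). \<chi> i. frechet_derivative (\<lambda>y. \<phi> (t, y)) (at x) (axis i 1))"

definition space_hess :: "(('d::finite) point \<Rightarrow> real) \<Rightarrow> 'd point \<Rightarrow> real ^ 'd ^ 'd"
  where "space_hess \<phi> = (\<lambda>(t, x). jacobian (\<lambda>y. space_grad \<phi> (t, y)) (at x))"

definition C12 :: "real \<Rightarrow> (('d::finite) point \<Rightarrow> real) \<Rightarrow> bool"
  where "C12 T \<phi> \<longleftrightarrow>
    (\<forall>t\<in>{0..T}. \<forall>x.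
       (\<lambda>s. \<phi> (s, x)) differentiable (at t within {0..T}) \<and>
       (\<lambda>y. \<phi> (t, y)) differentiable (at x) \<and>
       (\<lambda>y. space_grad \<phi> (t, y)) differentiable (at x)) \<and>
    continuous_on (Qbar T) \<phi> \<and> continuous_on (Qbar T) (time_deriv T \<phi>) \<and>
    continuous_on (Qbar T) (space_grad \<phi>) \<and> continuous_on (Qbar T) (space_hess \<phi>)"

definition op_A ::
    "('a, 'd::finite, 'n::finite) hjb_data \<Rightarrow> 'a \<Rightarrow> ('d point \<Rightarrow> real) \<Rightarrow> 'd point \<Rightarrow> real"
  where "op_A D \<alpha> \<phi> p =
    1/2 * trace (diffus D \<alpha> p ** transpose (diffus D \<alpha> p) ** space_hess \<phi> p)
      + drift D \<alpha> p \<bullet> space_grad \<phi> p"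

definition op_K ::
    "('a, 'd::finite, 'n::finite) hjb_data \<Rightarrow> 'a \<Rightarrow> ('d point \<Rightarrow> real) \<Rightarrow> 'd point \<Rightarrow> real"
  where "op_K D \<alpha> \<phi> = (\<lambda>(t, x).
    LINT e|levy D. \<phi> (t, x + jump D \<alpha> (t, x) e) - \<phi> (t, x)
      - jump D \<alpha> (t, x) e \<bullet> space_grad \<phi> (t, x))"

definition op_L ::
    "('a, 'd::finite, 'n::finite) hjb_data \<Rightarrow> 'a \<Rightarrow> ('d point \<Rightarrow> real) \<Rightarrow> 'd point \<Rightarrow> real"
  where "op_L D \<alpha> \<phi> p = op_A D \<alpha> \<phi> p + op_K D \<alpha> \<phi> p"

definition op_B ::
    "('a, 'd::finite, 'n::finite) hjb_data \<Rightarrow> 'a \<Rightarrow> ('d point \<Rightarrow> real) \<Rightarrow> 'd point \<Rightarrow> real"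
  where "op_B D \<alpha> \<phi> = (\<lambda>(t, x).
    LINT e|levy D. modm D (\<phi> (t, x + jump D \<alpha> (t, x) e) - \<phi> (t, x)) * weight D (t, x) e)"

text \<open>
  For \<open>\<phi>\<close> of class \<open>C12\<close> and under \<open>assumption_A\<close>, the set whose infimum is taken is nonempty and
  bounded, uniformly in \<open>\<alpha>\<close>, so the real-valued \<open>INF\<close> is the genuine one.
\<close>

definition op_H ::
    "('a, 'd::finite, 'n::finite) hjb_data \<Rightarrow> ('d point \<Rightarrow> real) \<Rightarrow> 'd point \<Rightarrow> real"
  where "op_H D \<phi> p = time_deriv (Tm D) \<phi> p +
    (INF \<alpha>\<in>ctrl D. - op_L D \<alpha> \<phi> p
       - driver D \<alpha> p (\<phi> p) (transpose (diffus D \<alpha> p) *v space_grad \<phi> p) (op_B D \<alpha> \<phi> p))"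

definition G_VI ::
    "('a, 'd::finite, 'n::finite) hjb_data \<Rightarrow> ('d point \<Rightarrow> real) \<Rightarrow> 'd point \<Rightarrow> real"
  where "G_VI D \<phi> p = min (\<phi> p - obst D p) (op_H D \<phi> p)"

definition G_pen ::
    "('a, 'd::finite, 'n::finite) hjb_data \<Rightarrow> real \<Rightarrow> ('d point \<Rightarrow> real) \<Rightarrow> 'd point \<Rightarrow> real"
  where "G_pen D \<rho> \<phi> p = op_H D \<phi> p - \<rho> * max (obst D p - \<phi> p) 0"

section \<open>Viscosity solutions\<close>

definition usc_on :: "'b::topological_space set \<Rightarrow> ('b \<Rightarrow> real) \<Rightarrow> bool"
  where "usc_on S u \<longleftrightarrow> (\<forall>a. openin (top_of_set S) {p \<in> S. u p < a})"

definition lsc_on :: "'b::topological_space set \<Rightarrow> ('b \<Rightarrow> real) \<Rightarrow> bool"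
  where "lsc_on S u \<longleftrightarrow> (\<forall>a. openin (top_of_set S) {p \<in> S. u p > a})"

definition viscosity_subsolution ::
    "real \<Rightarrow> ((('d::finite) point \<Rightarrow> real) \<Rightarrow> 'd point \<Rightarrow> real) \<Rightarrow> (real ^ 'd \<Rightarrow> real) \<Rightarrow>
      ('d point \<Rightarrow> real) \<Rightarrow> bool"
  where "viscosity_subsolution T G g u \<longleftrightarrow>
    usc_on (Qbar T) u \<and>
    (\<forall>t\<in>{0..T}. \<forall>x. \<forall>\<phi>.
      C12 T \<phi> \<and> \<phi> (t, x) = u (t, x) \<and> (\<forall>q\<in>Qbar T. u q - \<phi> q \<le> u (t, x) - \<phi> (t, x)) \<longrightarrow>
      (if t > 0 then G \<phi> (t, x) \<le> 0 else min (G \<phi> (0, x)) (u (0, x) - g x) \<le> 0))"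

definition viscosity_supersolution ::
    "real \<Rightarrow> ((('d::finite) point \<Rightarrow> real) \<Rightarrow> 'd point \<Rightarrow> real) \<Rightarrow> (real ^ 'd \<Rightarrow> real) \<Rightarrow>
      ('d point \<Rightarrow> real) \<Rightarrow> bool"
  where "viscosity_supersolution T G g u \<longleftrightarrow>
    lsc_on (Qbar T) u \<and>
    (\<forall>t\<in>{0..T}. \<forall>x. \<forall>\<phi>.
      C12 T \<phi> \<and> \<phi> (t, x) = u (t, x) \<and> (\<forall>q\<in>Qbar T. u q - \<phi> q \<ge> u (t, x) - \<phi> (t, x)) \<longrightarrow>
      (if t > 0 then G \<phi> (t, x) \<ge> 0 else max (G \<phi> (0, x)) (u (0, x) - g x) \<ge> 0))"

definition viscosity_solution ::
    "real \<Rightarrow> ((('d::finite) point \<Rightarrow> real) \<Rightarrow> 'd point \<Rightarrow> real) \<Rightarrow> (real ^ 'd \<Rightarrow> real) \<Rightarrow>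
      ('d point \<Rightarrow> real) \<Rightarrow> bool"
  where "viscosity_solution T G g u \<longleftrightarrow>
    continuous_on (Qbar T) u \<and> viscosity_subsolution T G g u \<and> viscosity_supersolution T G g u"

definition bounded_viscosity_solution ::
    "real \<Rightarrow> ((('d::finite) point \<Rightarrow> real) \<Rightarrow> 'd point \<Rightarrow> real) \<Rightarrow> (real ^ 'd \<Rightarrow> real) \<Rightarrow>
      ('d point \<Rightarrow> real) \<Rightarrow> bool"
  where "bounded_viscosity_solution T G g u \<longleftrightarrow>
    bounded (u ` Qbar T) \<and> viscosity_solution T G g u"

section \<open>Contact sets and the Hausdorff distance\<close>

definition contact :: "('a, 'd::finite, 'n::finite) hjb_data \<Rightarrow> ('d point \<Rightarrow> real) \<Rightarrow> 'd point set"
  where "contact D u = {p \<in> Qbar (Tm D). u p = obst D p}"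

definition approx_contact ::
    "('a, 'd::finite, 'n::finite) hjb_data \<Rightarrow> real \<Rightarrow> real \<Rightarrow> real \<Rightarrow> ('d point \<Rightarrow> real) \<Rightarrow> 'd point set"
  where "approx_contact D C\<^sub>0 \<beta> \<rho> v =
    {p \<in> Qbar (Tm D). obst D p - C\<^sub>0 * \<rho> powr (-\<beta>) \<le> v p \<and> v p \<le> obst D p}"

text \<open>
  In \<^typ>\<open>ennreal\<close> an infimum over the empty set is \<open>\<infinity>\<close> and a supremum over it is \<open>0\<close>.
\<close>

definition excess :: "'b::metric_space set \<Rightarrow> 'b set \<Rightarrow> ennreal"
  where "excess S S' = (SUP x\<in>S. INF y\<in>S'. ennreal (dist x y))"

definition hausdorff_dist :: "'b::metric_space set \<Rightarrow> 'b set \<Rightarrow> ennreal"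
  where "hausdorff_dist S S' = max (excess S S') (excess S' S)"

end

theory Submission
  imports Defs
begin

text \<open>
  On the approximate contact set the value
  of \<open>u\<close> differs from the obstacle by at most \<open>C\<^sub>0 \<rho>\<^sup>-\<^sup>\<beta>\<close>, because both the penalization error
  and the defining tolerance of that set have this size and opposite signs. The gap \<open>u - \<zeta>\<close> is
  continuous, \<open>u\<close> as a viscosity solution and \<open>\<zeta>\<close> by its Lipschitz bound
  (\<open>continuous_on_Qbar_if_semi1_le\<close>), and on the compact set \<open>K\<close> a small
  value of a continuous function forces the point to be close to the zero set, uniformly in the point
  (\<open>excess_tendsto_0_if_small_values\<close>). This gives one excess. The other vanishes identically,
  since the error estimate puts the contact set inside every approximate contact set
  (\<open>contact_subset_approx_contact\<close>).
\<close>

lemma excess_eq_0_if_subset: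
  assumes "S \<subseteq> S'"
  shows "excess S S' = 0"
proof -
  have "(INF y\<in>S'. ennreal (dist x y)) = 0" if "x \<in> S" for x
    using INF_lower[of x S' "\<lambda>y. ennreal (dist x y)"] that assms by auto
  then show ?thesis
    unfolding excess_def by (auto intro!: antisym SUP_least)
qed

lemma excess_le_if_close:
  assumes "\<And>x. x \<in> S \<Longrightarrow> \<exists>y\<in>S'. dist x y \<le> \<epsilon>"
  shows "excess S S' \<le> ennreal \<epsilon>"
  unfolding excess_def using assms
  by (intro SUP_least) (meson INF_lower2 ennreal_leI)

text \<open>
  The points of \<open>K\<close> at distance at least \<open>\<epsilon>\<close> from the zero set of \<open>w\<close> form a compact set, on which
  \<open>\<bar>w\<bar>\<close> is bounded below by some \<open>\<delta> > 0\<close>; such points thus leave \<open>S \<rho>\<close> once the bound \<open>h \<rho>\<close> is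
  below \<open>\<delta>\<close>. When the zero set is empty this says that \<open>S \<rho>\<close> is eventually empty, so that
  its excess is \<open>0\<close> and not \<open>\<infinity>\<close>.
\<close>

lemma excess_tendsto_0_if_small_values:
  fixes w :: "'b::metric_space \<Rightarrow> real"
  assumes "compact K" and "continuous_on K w" and "(h \<longlongrightarrow> 0) F"
    and small: "\<forall>\<^sub>F \<rho> in F. S \<rho> \<subseteq> {y \<in> K. \<bar>w y\<bar> \<le> h \<rho>}"
  shows "((\<lambda>\<rho>. excess (S \<rho>) {x \<in> K. w x = 0}) \<longlongrightarrow> 0) F"
proof (rule order_tendstoI)
  fix a :: ennreal
  assume "0 < a"
  then obtain b where b: "0 < b" "b < a"
    using dense by blast
  then obtain \<epsilon> where \<epsilon>: "b = ennreal \<epsilon>" "0 < \<epsilon>"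
    by (cases b) (auto simp: top_unique)
  define Z where "Z = {x \<in> K. w x = 0}"
  define far where "far = K - (\<Union>x\<in>Z. ball x \<epsilon>)"
  have "compact far"
    unfolding far_def by (intro compact_diff assms open_UN) auto
  obtain \<delta> where \<delta>: "0 < \<delta>" "\<And>y. y \<in> far \<Longrightarrow> \<delta> \<le> \<bar>w y\<bar>"
  proof (cases "far = {}")
    case True
    then show ?thesis using that[of 1] by auto
  next
    case False
    have "continuous_on far (\<lambda>y. \<bar>w y\<bar>)"
      using assms(2) unfolding far_def by (auto intro!: continuous_intros intro: continuous_on_subset)
    from continuous_attains_inf[OF \<open>compact far\<close> False this]
    obtain y where y: "y \<in> far" "\<And>y'. y' \<in> far \<Longrightarrow> \<bar>w y\<bar> \<le> \<bar>w y'\<bar>"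
      by blast
    have "w y \<noteq> 0"
      using y(1) \<epsilon>(2) unfolding far_def Z_def by force
    then show ?thesis using y that[of "\<bar>w y\<bar>"] by auto
  qed
  have "\<forall>\<^sub>F \<rho> in F. h \<rho> < \<delta>"
    using assms(3) \<delta>(1) by (rule order_tendstoD)
  with small show "\<forall>\<^sub>F \<rho> in F. excess (S \<rho>) {x \<in> K. w x = 0} < a"
  proof eventually_elim
    case (elim \<rho>)
    have "\<exists>x\<in>Z. dist y x \<le> \<epsilon>" if "y \<in> S \<rho>" for y
    proof -
      have "y \<in> K" "y \<notin> far"
        using elim that \<delta>(2)[of y] by auto
      then show ?thesis
        unfolding far_def by (auto simp: dist_commute intro: less_imp_le)
    qed
    then have "excess (S \<rho>) Z \<le> b"
      unfolding \<epsilon>(1) by (rule excess_le_if_close)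
    then show ?case using b(2) unfolding Z_def by (rule le_less_trans)
  qed
qed auto

lemma norm_diff_le_if_semi1_le:
  fixes h :: "('d::finite) point \<Rightarrow> 'b::real_normed_vector"
  assumes "semi1 T h \<le> ennreal C" and "0 \<le> C" and "t \<in> {0..T}"
  shows "norm (h (t, x) - h (t, x')) \<le> C * norm (x - x')"
proof (cases "x = x'")
  case False
  have "ennreal (norm (h (t, x) - h (t, x')) / norm (x - x')) \<le> semi1 T h"
    unfolding semi1_def using False assms(3)
    by (intro SUP_upper2[of t] SUP_upper2[of x] SUP_upper2[of x']) auto
  also note assms(1)
  finally have "norm (h (t, x) - h (t, x')) / norm (x - x') \<le> C"
    using assms(2) by simp
  then show ?thesis using False by (simp add: divide_le_eq)
qed simp

text \<open>
  Separate continuity in time suffices for joint continuity because the Lipschitz constant in space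
  is the same at all times.
\<close>

lemma continuous_on_Qbar_if_semi1_le:
  fixes h :: "('d::finite) point \<Rightarrow> 'b::real_normed_vector"
  assumes "semi1 T h \<le> ennreal C" and "0 \<le> C"
    and "\<And>x. continuous_on {0..T} (\<lambda>t. h (t, x))"
  shows "continuous_on (Qbar T) h"
proof -
  have "C-lipschitz_on UNIV (\<lambda>x. h (t, x))" if "t \<in> {0..T}" for t
    using norm_diff_le_if_semi1_le[OF assms(1,2) that] assms(2)
    by (auto simp: lipschitz_on_def dist_norm)
  then have "local_lipschitz {0..T} UNIV (\<lambda>t x. h (t, x))"
    by (intro local_lipschitzI exI[of _ 1] conjI exI[of _ C] ballI)
      (auto intro: lipschitz_on_subset)
  then have "continuous_on ({0..T} \<times> UNIV) (\<lambda>(t, x). h (t, x))"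
    using assms(3) by (intro continuous_on_TimesI)
  then show ?thesis
    unfolding Qbar_def by simp
qed

text \<open>
  The Lipschitz bound on the obstacle is part of an estimate that is quantified over the controls;
  it is available because the control set is nonempty.
\<close>

lemma assumption_A_continuous_on_obst:
  fixes D :: "('a::metric_space, 'd::finite, 'n::finite) hjb_data"
  assumes "assumption_A D"
  shows "continuous_on (Qbar (Tm D)) (obst D)"
proof -
  obtain C \<alpha> where C: "C > 0" "assumption_coeff D C" and \<alpha>: "\<alpha> \<in> ctrl D"
    using assms unfolding assumption_A_def by blast
  have "semi1 (Tm D) (obst D) \<le> norm1 (Tm D) (obst D)"
    unfolding norm1_def by simp
  also have "\<dots> \<le> norm1 (Tm D) (drift D \<alpha>) + norm1 (Tm D) (diffus D \<alpha>) + norm1 (Tm D) (obst D)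
      + norm1 (Tm D) ((init D \<circ> snd) :: 'd point \<Rightarrow> real)"
    by (intro add_increasing2[OF zero_le] add_increasing[OF zero_le] order_refl)
  also have "\<dots> \<le> ennreal C"
    using C(2) \<alpha> unfolding assumption_coeff_def by blast
  finally have "semi1 (Tm D) (obst D) \<le> ennreal C" .
  moreover have "continuous_on {0..Tm D} (\<lambda>t. obst D (t, x))" for x
    using C(2) unfolding assumption_coeff_def by blast
  ultimately show ?thesis
    using C(1) by (intro continuous_on_Qbar_if_semi1_le[of _ _ C]) simp_all
qed

lemma contact_subset_approx_contact:
  assumes "\<And>p. p \<in> Qbar (Tm D) \<Longrightarrow> 0 \<le> u p - v p \<and> u p - v p \<le> C\<^sub>0 * \<rho> powr (-\<beta>)"
  shows "contact D u \<subseteq> approx_contact D C\<^sub>0 \<beta> \<rho> v"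
proof
  fix p
  assume "p \<in> contact D u"
  then show "p \<in> approx_contact D C\<^sub>0 \<beta> \<rho> v"
    using assms[of p] unfolding contact_def approx_contact_def by auto
qed

text \<open>
  The two bounds by \<open>C\<^sub>0 \<rho>\<^sup>-\<^sup>\<beta>\<close> do not add up: above the obstacle only the error estimate
  contributes, and below it only the tolerance in the approximate contact set.
\<close>

lemma approx_contact_gap_le:
  assumes "\<And>p. p \<in> Qbar (Tm D) \<Longrightarrow> 0 \<le> u p - v p \<and> u p - v p \<le> C\<^sub>0 * \<rho> powr (-\<beta>)"
    and "p \<in> approx_contact D C\<^sub>0 \<beta> \<rho> v"
  shows "\<bar>u p - obst D p\<bar> \<le> C\<^sub>0 * \<rho> powr (-\<beta>)"
  using assms(1)[of p] assms(2) unfolding approx_contact_def by auto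

theorem theorem3p5:
  fixes D :: "('a::metric_space, 'd::finite, 'n::finite) hjb_data"
    and u :: "'d point \<Rightarrow> real"
    and u\<rho> :: "real \<Rightarrow> 'd point \<Rightarrow> real"
    and C\<^sub>0 \<beta> :: real
    and K :: "'d point set"
  assumes "assumption_A D"
    and "bounded_viscosity_solution (Tm D) (G_VI D) (init D) u"
    and "\<And>\<rho>. \<rho> > 0 \<Longrightarrow> bounded_viscosity_solution (Tm D) (G_pen D \<rho>) (init D) (u\<rho> \<rho>)"
    and "C\<^sub>0 > 0" and "0 < \<beta>" and "\<beta> \<le> 1"
    and "\<And>\<rho> p. \<rho> > 0 \<Longrightarrow> p \<in> Qbar (Tm D) \<Longrightarrow>
           0 \<le> u p - u\<rho> \<rho> p \<and> u p - u\<rho> \<rho> p \<le> C\<^sub>0 * \<rho> powr (-\<beta>)"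
    and "compact K" and "K \<subseteq> Qbar (Tm D)"
  shows "((\<lambda>\<rho>. hausdorff_dist (approx_contact D C\<^sub>0 \<beta> \<rho> (u\<rho> \<rho>) \<inter> K) (contact D u \<inter> K))
            \<longlongrightarrow> 0) at_top \<and>
         ((\<lambda>\<rho>. SUP y\<in>approx_contact D C\<^sub>0 \<beta> \<rho> (u\<rho> \<rho>) \<inter> K. INF x\<in>contact D u \<inter> K. ennreal (dist x y))
            \<longlongrightarrow> 0) at_top"
proof -
  let ?A = "\<lambda>\<rho>. approx_contact D C\<^sub>0 \<beta> \<rho> (u\<rho> \<rho>) \<inter> K"
  let ?Z = "contact D u \<inter> K"
  have Z: "?Z = {x \<in> K. u x - obst D x = 0}"
    using assms(9) unfolding contact_def by auto
  have "continuous_on (Qbar (Tm D)) u"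
    using assms(2) unfolding bounded_viscosity_solution_def viscosity_solution_def by blast
  then have "continuous_on K (\<lambda>p. u p - obst D p)"
    using assumption_A_continuous_on_obst[OF assms(1)] assms(9)
    by (intro continuous_intros) (auto intro: continuous_on_subset)
  moreover have "((\<lambda>\<rho>. C\<^sub>0 * \<rho> powr (-\<beta>)) \<longlongrightarrow> 0) at_top"
    using assms(5) by (intro tendsto_mult_right_zero tendsto_neg_powr filterlim_ident) auto
  moreover have "\<forall>\<^sub>F \<rho> in at_top. ?A \<rho> \<subseteq> {y \<in> K. \<bar>u y - obst D y\<bar> \<le> C\<^sub>0 * \<rho> powr (-\<beta>)}"
    using eventually_gt_at_top[of 0]
  proof eventually_elim
    case (elim \<rho>)
    show ?case
      using approx_contact_gap_le[of D u "u\<rho> \<rho>", OF assms(7)[OF elim]] by blast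
  qed
  ultimately have lim: "((\<lambda>\<rho>. excess (?A \<rho>) ?Z) \<longlongrightarrow> 0) at_top"
    unfolding Z by (rule excess_tendsto_0_if_small_values[OF assms(8)])
  have "\<forall>\<^sub>F \<rho> in at_top. excess (?A \<rho>) ?Z = hausdorff_dist (?A \<rho>) ?Z"
    using eventually_gt_at_top[of 0]
  proof eventually_elim
    case (elim \<rho>)
    have "excess ?Z (?A \<rho>) = 0"
      using contact_subset_approx_contact[of D u "u\<rho> \<rho>", OF assms(7)[OF elim]]
      by (intro excess_eq_0_if_subset) blast
    then show ?case unfolding hausdorff_dist_def by simp
  qed
  with lim have "((\<lambda>\<rho>. hausdorff_dist (?A \<rho>) ?Z) \<longlongrightarrow> 0) at_top"
    by (rule Lim_transform_eventually)
  moreover have "(SUP y\<in>?A \<rho>. INF x\<in>?Z. ennreal (dist x y)) = excess (?A \<rho>) ?Z" for \<rho>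
    unfolding excess_def by (simp add: dist_commute)
  ultimately show ?thesis using lim by simp
qed

end
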